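(* Let the agents' utilities be additive and lexicographic, and let $p$ be an assignment. Then $p$ is not Pareto optimal if and only if there exists a directed cycle in the graph $G(p)$ which contains at least one edge corresponding to a strict preference.
   Context: $N=\{1,\dots,n\}$ is a set of agents and $O=\{o_1,\dots,o_m\}$ a set of objects. An assignment $p=(p(1),\dots,p(n))$ is a partition of $O$ into $n$ (possibly empty) subsets, $p(i)$ being the bundle of agent $i$. Each agent $i$ has a utility $u_i(o)\ge 0$ for each object, extended additively: $u_i(S)=\sum_{o\in S}u_i(o)$ for $S\subseteq O$. Write $o\succ_i o'$ if $u_i(o)>u_i(o')$, $o\sim_i o'$ if $u_i(o)=u_i(o')$, and $o\succsim_i o'$ if $u_i(o)\ge u_i(o')$. Utilities are lexicographic if for every $i\in N$ and $o\in O$, $u_i(o)>\sum_{o'\in O:\, o\succ_i o'}u_i(o')$, with the empty sum equal to $0$ (so $u_i(o)>0$ for all $o$; ties between objects are allowed). Assignment $q$ Pareto dominates $p$ if $u_i(q(i))\ge u_i(p(i))$ for all $i\in N$ and $u_i(q(i))>u_i(p(i))$ for at least one $i\in N$. An assignment is Pareto optimal if no assignment Pareto dominates it. The directed graph $G(p)=(V(p),E(p))$ has vertex set $V(p)=O$; for each object $o$, with $i$ the agent such that $o\in p(i)$, there is an edge $(o,o')$ for every $o'\in O\setminus\{o\}$ with $o'\succsim_i o$. The edge $(o,o')$ corresponds to a strict preference if $o'\succ_i o$, and to an indifference if $o'\sim_i o$. *)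

theory Defs
  imports Complex_Main "HOL-Library.Disjoint_Sets" "Graph_Theory.Pair_Digraph"
begin

text \<open>
  Agents are the numbers in \<open>{1..n}\<close>, \<open>Ob\<close> is the set of objects and \<open>u i x\<close> is the utility of
  agent \<open>i\<close> for the object \<open>x\<close>.  The values of \<open>u\<close> and of assignments at indices outside
  \<open>{1..n}\<close>, and those of \<open>u i\<close> outside \<open>Ob\<close>, are irrelevant to all notions below.
\<close>

definition bundle_utility :: "(nat \<Rightarrow> 'o \<Rightarrow> real) \<Rightarrow> nat \<Rightarrow> 'o set \<Rightarrow> real" where
  "bundle_utility u i S = (\<Sum>x\<in>S. u i x)"

definition strictly_prefers :: "(nat \<Rightarrow> 'o \<Rightarrow> real) \<Rightarrow> nat \<Rightarrow> 'o \<Rightarrow> 'o \<Rightarrow> bool" where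
  "strictly_prefers u i x y \<longleftrightarrow> u i x > u i y"

definition weakly_prefers :: "(nat \<Rightarrow> 'o \<Rightarrow> real) \<Rightarrow> nat \<Rightarrow> 'o \<Rightarrow> 'o \<Rightarrow> bool" where
  "weakly_prefers u i x y \<longleftrightarrow> u i x \<ge> u i y"

definition lexicographic :: "nat \<Rightarrow> 'o set \<Rightarrow> (nat \<Rightarrow> 'o \<Rightarrow> real) \<Rightarrow> bool" where
  "lexicographic n Ob u \<longleftrightarrow>
     (\<forall>i\<in>{1..n}. \<forall>x\<in>Ob. u i x > (\<Sum>y\<in>{y\<in>Ob. strictly_prefers u i x y}. u i y))"

text \<open>Bundles may be empty, so \<^const>\<open>partition_on\<close> is not applicable.\<close>

definition assignment :: "nat \<Rightarrow> 'o set \<Rightarrow> (nat \<Rightarrow> 'o set) \<Rightarrow> bool" where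
  "assignment n Ob p \<longleftrightarrow> (\<Union>i\<in>{1..n}. p i) = Ob \<and> disjoint_family_on p {1..n}"

definition pareto_dominates ::
    "nat \<Rightarrow> (nat \<Rightarrow> 'o \<Rightarrow> real) \<Rightarrow> (nat \<Rightarrow> 'o set) \<Rightarrow> (nat \<Rightarrow> 'o set) \<Rightarrow> bool" where
  "pareto_dominates n u q p \<longleftrightarrow>
     (\<forall>i\<in>{1..n}. bundle_utility u i (q i) \<ge> bundle_utility u i (p i)) \<and>
     (\<exists>i\<in>{1..n}. bundle_utility u i (q i) > bundle_utility u i (p i))"

definition pareto_optimal ::
    "nat \<Rightarrow> 'o set \<Rightarrow> (nat \<Rightarrow> 'o \<Rightarrow> real) \<Rightarrow> (nat \<Rightarrow> 'o set) \<Rightarrow> bool" where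
  "pareto_optimal n Ob u p \<longleftrightarrow>
     assignment n Ob p \<and> \<not> (\<exists>q. assignment n Ob q \<and> pareto_dominates n u q p)"

definition exchange_graph ::
    "nat \<Rightarrow> 'o set \<Rightarrow> (nat \<Rightarrow> 'o \<Rightarrow> real) \<Rightarrow> (nat \<Rightarrow> 'o set) \<Rightarrow> 'o pair_pre_digraph" where
  "exchange_graph n Ob u p =
     \<lparr> pverts = Ob,
       parcs = {(x, y). x \<in> Ob \<and> y \<in> Ob - {x} \<and>
                        (\<exists>i\<in>{1..n}. x \<in> p i \<and> weakly_prefers u i y x)} \<rparr>"

text \<open>The preference attached to an edge is that of the owner of its tail.\<close>

definition strict_edge ::
    "nat \<Rightarrow> (nat \<Rightarrow> 'o \<Rightarrow> real) \<Rightarrow> (nat \<Rightarrow> 'o set) \<Rightarrow> 'o \<times> 'o \<Rightarrow> bool" where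
  "strict_edge n u p e \<longleftrightarrow> (\<exists>i\<in>{1..n}. fst e \<in> p i \<and> strictly_prefers u i (snd e) (fst e))"

end

theory Submission
  imports Defs "HOL-Combinatorics.Permutations"
begin

text \<open>
  A cycle acts on the objects as a permutation sending each tail to its head.  Letting every owner
  of a tail receive the head is a weak improvement for everybody, and a strict one for the owner of
  the tail of a strict edge.

  Conversely, suppose that \<open>q\<close> Pareto dominates \<open>p\<close> and choose \<open>q\<close> so that as few objects as
  possible change hands.  By lexicographicity, an agent who loses \<open>x\<close> must gain some object that is
  at least as good as \<open>x\<close>; as that object was lost by somebody else, following these edges leads to
  a cycle.  If all its edges were indifferences, undoing this trade in \<open>q\<close> would preserve all
  utilities and decrease the number of objects that change hands.
\<close>

section \<open>Cycles as permutations of their vertices\<close>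

text \<open>Reading the vertices of the closed walk once as its start followed by the heads, and
  once as the tails followed by the last head, shows that heads and tails form the same multiset.
  The heads of a cycle are distinct, hence so are the tails.\<close>

lemma cycle_permutes:
  fixes G :: "'a pair_pre_digraph"
  assumes "pre_digraph.cycle (with_proj G) c"
  obtains \<sigma> where "\<sigma> permutes fst ` set c" "\<And>x y. (x, y) \<in> set c \<Longrightarrow> \<sigma> x = y"
proof -
  interpret pre_digraph "with_proj G" .
  obtain w where w: "awalk w c w" "distinct (tl (awalk_verts w c))" "c \<noteq> []"
    using assms unfolding cycle_def by blast
  have cas: "cas w c w" using w(1) by (simp add: awalk_def)
  have "awalk_verts w c = w # map snd c"
    using awalk_verts_conv'[OF cas] w(3) cas by (simp add: cas_simp)
  moreover have "awalk_verts w c = map fst c @ [snd (last c)]"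
    using w(3) by (simp add: awalk_verts_conv)
  ultimately have heads: "distinct (map snd c)"
    and walk: "w # map snd c = map fst c @ [snd (last c)]"
    using w(2) by auto
  have "snd (last es) = y" if "cas x es y" "es \<noteq> []" for x es y
    using that by (induction es arbitrary: x) (auto split: if_splits)
  then have "snd (last c) = w" using cas w(3) .
  then have "mset (map snd c) = mset (map fst c)"
    using arg_cong[OF walk, of mset] by simp
  then have tails: "distinct (map fst c)" and same: "snd ` set c = fst ` set c"
    using heads mset_eq_imp_distinct_iff mset_eq_setD list.set_map by metis+
  \<comment> \<open>Distinct tails make \<open>map_of c\<close> return the head of each edge; the
    default value fixes all other objects, as \<open>permutes\<close> demands.\<close>
  define \<sigma> where "\<sigma> x = (case map_of c x of None \<Rightarrow> x | Some y \<Rightarrow> y)" for x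
  have \<sigma>: "\<sigma> x = y" if "(x, y) \<in> set c" for x y
    using that tails by (simp add: \<sigma>_def)
  have "inj_on \<sigma> (fst ` set c)"
  proof (rule inj_onI)
    fix x x' assume "x \<in> fst ` set c" "x' \<in> fst ` set c" and eq: "\<sigma> x = \<sigma> x'"
    then obtain y y' where "(x, y) \<in> set c" "(x', y') \<in> set c" by auto
    moreover from this have "y = y'" using eq \<sigma> by simp
    ultimately show "x = x'"
      using heads inj_onD[of snd "set c" "(x, y)" "(x', y')"] by (simp add: distinct_map)
  qed
  moreover have "\<sigma> ` fst ` set c = snd ` set c"
    by (force simp: \<sigma> image_image)
  moreover have "\<sigma> x = x" if "x \<notin> fst ` set c" for x
    using that by (simp add: \<sigma>_def map_of_eq_None_iff[THEN iffD2])
  ultimately have "\<sigma> permutes fst ` set c"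
    by (intro bij_imp_permutes) (auto simp: bij_betw_def same)
  then show thesis using \<sigma> that by blast
qed

text \<open>In a finite acyclic graph the converse of the arc relation is well-founded, and a
  minimal vertex for it would have no outgoing arc.\<close>

lemma cycle_exists:
  fixes G :: "'a pair_pre_digraph"
  assumes "pair_wf_digraph G" "finite (parcs G)" "x \<in> pverts G"
    and succ: "\<And>x. x \<in> pverts G \<Longrightarrow> \<exists>y. (x, y) \<in> parcs G"
  shows "\<exists>c. pre_digraph.cycle (with_proj G) c"
proof -
  interpret pair_wf_digraph G by fact
  have "\<not> wf ((parcs G)\<inverse>)"
  proof
    assume "wf ((parcs G)\<inverse>)"
    then obtain z where "z \<in> pverts G" "\<And>y. (y, z) \<in> (parcs G)\<inverse> \<Longrightarrow> y \<notin> pverts G"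
      using assms(3) by (meson wfE_min)
    then show False using succ by (meson converseI in_arcsD2)
  qed
  then have "\<not> acyclic (parcs G)"
    using assms(2) finite_acyclic_wf_converse by blast
  then obtain z where "(z, z) \<in> (parcs G)\<^sup>+"
    by (auto simp: acyclic_def)
  then obtain c where "awalk z c z" "c \<noteq> []"
    using reachable1_awalk by auto
  then have "closed_w c" by (auto simp: closed_w_def)
  then show ?thesis using closed_w_imp_cycle by blast
qed

section \<open>Trading along a permutation\<close>

lemma assignment_owner_unique:
  assumes "assignment n Ob p" "x \<in> p i" "x \<in> p j" "i \<in> {1..n}" "j \<in> {1..n}"
  shows "i = j"
proof (rule ccontr)
  assume "i \<noteq> j"
  then have "p i \<inter> p j = {}"
    using assms(1,4,5) disjoint_family_onD unfolding assignment_def by metis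
  then show False using assms(2,3) by blast
qed

lemma assignment_permute:
  assumes "assignment n Ob p" "\<sigma> permutes Ob"
  shows "assignment n Ob (\<lambda>i. \<sigma> ` p i)"
proof -
  have "(\<Union>i\<in>{1..n}. \<sigma> ` p i) = \<sigma> ` (\<Union>i\<in>{1..n}. p i)" by blast
  then have "(\<Union>i\<in>{1..n}. \<sigma> ` p i) = Ob"
    using assms by (simp add: assignment_def permutes_image)
  moreover have "\<sigma> ` p i \<inter> \<sigma> ` p j = {}" if "p i \<inter> p j = {}" for i j
    using that permutes_inj[OF assms(2)] by (metis image_Int image_empty)
  ultimately show ?thesis
    using assms(1) by (auto simp: assignment_def disjoint_family_on_def)
qed

lemma bundle_utility_permute:
  assumes "\<sigma> permutes A"
  shows "bundle_utility u i (\<sigma> ` S) = (\<Sum>x\<in>S. u i (\<sigma> x))"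
  unfolding bundle_utility_def
  by (subst sum.reindex) (use permutes_inj_on[OF assms] in auto)

lemma cycle_imp_dominated:
  assumes fin: "finite Ob" and p: "assignment n Ob p"
    and c: "pre_digraph.cycle (with_proj (exchange_graph n Ob u p)) c"
    and e: "e \<in> set c" "strict_edge n u p e"
  shows "\<exists>q. assignment n Ob q \<and> pareto_dominates n u q p"
proof -
  obtain \<sigma> where \<sigma>: "\<sigma> permutes fst ` set c" "\<And>x y. (x, y) \<in> set c \<Longrightarrow> \<sigma> x = y"
    using cycle_permutes[OF c] by blast
  have arcs: "set c \<subseteq> parcs (exchange_graph n Ob u p)"
    using c by (auto simp: pre_digraph.cycle_def pre_digraph.awalk_def)
  then have "fst ` set c \<subseteq> Ob" by (auto simp: exchange_graph_def)
  then have perm: "\<sigma> permutes Ob" using \<sigma>(1) permutes_subset by blast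
  have finp: "finite (p i)" if "i \<in> {1..n}" for i
    using that p fin by (metis UN_upper assignment_def finite_subset)
  \<comment> \<open>Objects off the cycle stay put. For a tail on the cycle, the agent witnessing
    the edge is \<open>i\<close> itself, because owners are unique.\<close>
  have weak: "u i x \<le> u i (\<sigma> x)" if i: "i \<in> {1..n}" "x \<in> p i" for i x
  proof (cases "x \<in> fst ` set c")
    case True
    then obtain y where "(x, y) \<in> set c" by auto
    then obtain j where "j \<in> {1..n}" "x \<in> p j" "u j x \<le> u j y"
      using arcs by (auto simp: exchange_graph_def weakly_prefers_def)
    moreover from this have "j = i" using assignment_owner_unique[OF p] i by blast
    ultimately show ?thesis using \<sigma>(2) \<open>(x, y) \<in> set c\<close> by simp
  next
    case False
    then show ?thesis using \<sigma>(1) by (simp add: permutes_not_in)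
  qed
  obtain i where i: "i \<in> {1..n}" "fst e \<in> p i" "u i (fst e) < u i (snd e)"
    using e(2) by (auto simp: strict_edge_def strictly_prefers_def)
  have "\<sigma> (fst e) = snd e" using e(1) \<sigma>(2) by (metis prod.collapse)
  then have "bundle_utility u i (p i) < bundle_utility u i (\<sigma> ` p i)"
    unfolding bundle_utility_permute[OF perm] unfolding bundle_utility_def
    using i weak finp by (intro sum_strict_mono_ex1) (auto intro!: bexI[of _ "fst e"])
  moreover have "bundle_utility u j (p j) \<le> bundle_utility u j (\<sigma> ` p j)" if "j \<in> {1..n}" for j
    unfolding bundle_utility_permute[OF perm] unfolding bundle_utility_def
    using that weak by (intro sum_mono) auto
  ultimately have "pareto_dominates n u (\<lambda>i. \<sigma> ` p i) p"
    using i(1) by (auto simp: pareto_dominates_def)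
  then show ?thesis using assignment_permute[OF p perm] by blast
qed

section \<open>From a dominating assignment to a cycle\<close>

text \<open>Otherwise all objects of \<open>T - S\<close> are strictly worse than \<open>x\<close>,
  so together they are worth less than \<open>x\<close> alone and thus less than
  \<open>S - T\<close>. Adding back the common part \<open>S \<inter> T\<close> contradicts
  \<open>le\<close>.\<close>

lemma lexicographic_compensation:
  assumes fin: "finite Ob"
    and nonneg: "\<And>x. x \<in> Ob \<Longrightarrow> u i x \<ge> 0"
    and lex: "lexicographic n Ob u" "i \<in> {1..n}"
    and sub: "S \<subseteq> Ob" "T \<subseteq> Ob"
    and le: "bundle_utility u i S \<le> bundle_utility u i T"
    and x: "x \<in> S - T"
  shows "\<exists>y\<in>T - S. weakly_prefers u i y x"
proof (rule ccontr)
  assume "\<not> ?thesis"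
  then have worse: "T - S \<subseteq> {y\<in>Ob. strictly_prefers u i x y}"
    using sub by (auto simp: weakly_prefers_def strictly_prefers_def not_le)
  have finST: "finite S" "finite T" using sub fin finite_subset by auto
  have "sum (u i) (T - S) \<le> sum (u i) {y\<in>Ob. strictly_prefers u i x y}"
    using worse fin nonneg by (intro sum_mono2) auto
  also have "\<dots> < u i x"
    using lex x sub by (auto simp: lexicographic_def)
  also have "\<dots> \<le> sum (u i) (S - T)"
    using x finST nonneg sub by (intro member_le_sum) auto
  finally have "sum (u i) (T - S) < sum (u i) (S - T)" .
  moreover have "sum (u i) T = sum (u i) (T - S) + sum (u i) (S \<inter> T)"
    using finST by (metis Int_commute add.commute sum.Int_Diff)
  moreover have "sum (u i) S = sum (u i) (S - T) + sum (u i) (S \<inter> T)"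
    using finST by (metis add.commute sum.Int_Diff)
  ultimately show False using le by (simp add: bundle_utility_def)
qed

text \<open>Only objects that change hands between \<open>p\<close> and \<open>q\<close> occur, and
  each arc replaces a lost object by one gained by the same agent. This is what allows a cycle to be
  undone in \<open>q\<close>; a cycle of the exchange graph need not have this property.\<close>

definition trade_graph ::
    "nat \<Rightarrow> (nat \<Rightarrow> 'o \<Rightarrow> real) \<Rightarrow> (nat \<Rightarrow> 'o set) \<Rightarrow> (nat \<Rightarrow> 'o set) \<Rightarrow> 'o pair_pre_digraph" where
  "trade_graph n u p q =
     \<lparr> pverts = (\<Union>i\<in>{1..n}. p i - q i),
       parcs = {(x, y). \<exists>i\<in>{1..n}. x \<in> p i - q i \<and> y \<in> q i - p i \<and> weakly_prefers u i y x} \<rparr>"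

text \<open>This makes every head of an arc of \<open>trade_graph\<close> a vertex, so that a path
  can always be continued.\<close>

lemma gained_imp_lost:
  assumes "assignment n Ob p" "assignment n Ob q" "i \<in> {1..n}" "x \<in> q i - p i"
  shows "\<exists>j\<in>{1..n}. x \<in> p j - q j"
proof -
  have "x \<in> Ob" using assms(2-4) by (auto simp: assignment_def)
  then obtain j where j: "j \<in> {1..n}" "x \<in> p j" using assms(1) by (auto simp: assignment_def)
  then have "j \<noteq> i" using assms(4) by blast
  then have "x \<notin> q j" using j assms assignment_owner_unique[OF assms(2)] by blast
  then show ?thesis using j by blast
qed

text \<open>The trade graph is a subgraph: a lost object differs from a gained one, so no loops
  arise. Cycles carry over to larger graphs.\<close>

lemma cycle_trade_imp_cycle_exchange:
  assumes "assignment n Ob p" "assignment n Ob q"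
    and "pre_digraph.cycle (with_proj (trade_graph n u p q)) c"
  shows "pre_digraph.cycle (with_proj (exchange_graph n Ob u p)) c"
proof -
  have "parcs (trade_graph n u p q) \<subseteq> parcs (exchange_graph n Ob u p)"
    using assms(1,2) by (auto simp: trade_graph_def exchange_graph_def assignment_def)
  moreover have "pverts (trade_graph n u p q) \<subseteq> pverts (exchange_graph n Ob u p)"
    using assms(1) by (auto simp: trade_graph_def exchange_graph_def assignment_def)
  ultimately show ?thesis using assms(3)
    by (auto simp: pre_digraph.cycle_def pre_digraph.awalk_def cas_with_proj_eq
        awalk_verts_with_proj_eq)
qed

text \<open>The minimal choice of \<open>q\<close> takes the form of strong induction on the number
  of lost objects: a cycle of indifferences leads to another dominating assignment with fewer
  losses.\<close>

lemma dominated_imp_cycle: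
  assumes fin: "finite Ob"
    and nonneg: "\<And>i x. i \<in> {1..n} \<Longrightarrow> x \<in> Ob \<Longrightarrow> u i x \<ge> 0"
    and lex: "lexicographic n Ob u"
    and p: "assignment n Ob p"
    and "assignment n Ob q" "pareto_dominates n u q p"
  shows "\<exists>c. pre_digraph.cycle (with_proj (exchange_graph n Ob u p)) c \<and>
         (\<exists>e\<in>set c. strict_edge n u p e)"
  using assms(5,6)
proof (induction "card (\<Union>i\<in>{1..n}. p i - q i)" arbitrary: q rule: less_induct)
  case less
  note q = less.prems(1)
  let ?H = "trade_graph n u p q"
  have sub: "p i \<subseteq> Ob" "q i \<subseteq> Ob" if "i \<in> {1..n}" for i
    using that p q by (auto simp: assignment_def)
  have gain: "bundle_utility u i (p i) \<le> bundle_utility u i (q i)" if "i \<in> {1..n}" for i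
    using that less.prems(2) by (auto simp: pareto_dominates_def)
  have lost_finite: "finite (\<Union>i\<in>{1..n}. p i - q i)"
    using sub fin by (blast intro: finite_subset)
  have wf: "pair_wf_digraph ?H"
    using gained_imp_lost[OF p q] by unfold_locales (fastforce simp: trade_graph_def)+
  have "parcs ?H \<subseteq> pverts ?H \<times> pverts ?H"
    using pair_wf_digraph.in_arcsD1[OF wf] pair_wf_digraph.in_arcsD2[OF wf] by auto
  moreover have "finite (pverts ?H)"
    unfolding trade_graph_def pair_pre_digraph.select_convs by (rule lost_finite)
  ultimately have finite_arcs: "finite (parcs ?H)"
    using finite_subset[OF _ finite_cartesian_product] by blast
  have succ: "\<exists>y. (x, y) \<in> parcs ?H" if x: "x \<in> pverts ?H" for x
  proof -
    obtain i where i: "i \<in> {1..n}" "x \<in> p i - q i"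
      using x by (auto simp: trade_graph_def)
    then have "\<exists>y\<in>q i - p i. weakly_prefers u i y x"
      using lexicographic_compensation[OF fin nonneg lex i(1) sub gain] by blast
    then have "\<exists>y. \<exists>i\<in>{1..n}. x \<in> p i - q i \<and> y \<in> q i - p i \<and> weakly_prefers u i y x"
      using i by blast
    then show ?thesis by (simp add: trade_graph_def)
  qed
  obtain j where j: "j \<in> {1..n}" "bundle_utility u j (p j) < bundle_utility u j (q j)"
    using less.prems(2) by (auto simp: pareto_dominates_def)
  \<comment> \<open>If nobody lost anything, nobody gained anything either, yet agent
    \<open>j\<close> is strictly better off.\<close>
  have "\<exists>x. x \<in> pverts ?H"
  proof (rule ccontr)
    assume none: "\<not> ?thesis"
    then have lost: "p i - q i = {}" if "i \<in> {1..n}" for i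
      using that by (auto simp: trade_graph_def)
    then have "q j - p j = {}" using gained_imp_lost[OF p q j(1)] by blast
    then have "p j = q j" using lost[OF j(1)] by blast
    then show False using j(2) by simp
  qed
  then obtain c where c: "pre_digraph.cycle (with_proj ?H) c"
    using cycle_exists[OF wf finite_arcs _ succ] by blast
  have cycle: "pre_digraph.cycle (with_proj (exchange_graph n Ob u p)) c"
    using cycle_trade_imp_cycle_exchange[OF p q c] .
  show ?case
  proof (cases "\<exists>e\<in>set c. strict_edge n u p e")
    case True
    then show ?thesis using cycle by blast
  next
    case False
    obtain \<sigma> where \<sigma>: "\<sigma> permutes fst ` set c" "\<And>x y. (x, y) \<in> set c \<Longrightarrow> \<sigma> x = y"
      using cycle_permutes[OF c] by blast
    have arcs: "set c \<subseteq> parcs ?H" and "c \<noteq> []"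
      using c by (auto simp: pre_digraph.cycle_def pre_digraph.awalk_def)
    \<comment> \<open>Without strict edges, the weak preference along each edge becomes an equality
      of utilities.\<close>
    have edge: "\<exists>i\<in>{1..n}. x \<in> p i - q i \<and> \<sigma> x \<in> q i \<and> u i (\<sigma> x) = u i x"
      if x: "x \<in> fst ` set c" for x
    proof -
      obtain y where y: "(x, y) \<in> set c" using x by auto
      then obtain i where i: "i \<in> {1..n}" "x \<in> p i - q i" "y \<in> q i" "u i x \<le> u i y"
        using arcs by (auto simp: trade_graph_def weakly_prefers_def)
      have "\<not> strict_edge n u p (x, y)" using False y by blast
      then have "u i y \<le> u i x"
        using i by (auto simp: strict_edge_def strictly_prefers_def not_less)
      then show ?thesis using i \<sigma>(2)[OF y] by (intro bexI[of _ i]) simp_all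
    qed
    then have "fst ` set c \<subseteq> Ob" using sub by blast
    then have perm: "\<sigma> permutes Ob" using \<sigma>(1) permutes_subset by blast
    \<comment> \<open>Whoever holds \<open>\<sigma> x\<close> in \<open>q\<close> holds
      \<open>x\<close> in \<open>q'\<close>; for a tail \<open>x\<close> on the cycle this is its
      owner under \<open>p\<close>.\<close>
    define q' where "q' i = inv \<sigma> ` q i" for i
    have mem_q': "x \<in> q' i \<longleftrightarrow> \<sigma> x \<in> q i" for x i
      unfolding q'_def using permutes_inverses[OF perm] by (metis image_iff)
    have q': "assignment n Ob q'"
      unfolding q'_def using assignment_permute[OF q permutes_inv[OF perm]] .
    \<comment> \<open>If \<open>inv \<sigma> y\<close> lies on the cycle, its owner under
      \<open>p\<close> receives \<open>y\<close> in \<open>q\<close>, so that owner is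
      \<open>i\<close> and is indifferent by \<open>edge\<close>.\<close>
    have "u i (inv \<sigma> y) = u i y" if i: "i \<in> {1..n}" "y \<in> q i" for i y
    proof (cases "inv \<sigma> y \<in> fst ` set c")
      case True
      then obtain k where k: "k \<in> {1..n}" "y \<in> q k" "u k y = u k (inv \<sigma> y)"
        using edge[OF True] by (auto simp: permutes_inverses[OF perm])
      then have "k = i" using assignment_owner_unique[OF q] i by blast
      then show ?thesis using k by simp
    next
      case False
      then have "\<sigma> (inv \<sigma> y) = inv \<sigma> y" using permutes_not_in[OF \<sigma>(1)] by blast
      then show ?thesis by (simp add: permutes_inverses[OF perm])
    qed
    then have same: "bundle_utility u i (q' i) = bundle_utility u i (q i)" if "i \<in> {1..n}" for i
      using that unfolding q'_def bundle_utility_permute[OF permutes_inv[OF perm]]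
      by (simp add: bundle_utility_def)
    \<comment> \<open>Tails on the cycle return to their owners under \<open>p\<close>, and all
      other objects are fixed by \<open>\<sigma>\<close>, so no new loss arises.\<close>
    have smaller: "p i - q' i \<subseteq> p i - q i - fst ` set c" if i: "i \<in> {1..n}" for i
    proof
      fix x assume x: "x \<in> p i - q' i"
      have "x \<notin> fst ` set c"
      proof
        assume "x \<in> fst ` set c"
        then obtain k where k: "k \<in> {1..n}" "x \<in> p k" "\<sigma> x \<in> q k" using edge by blast
        then have "k = i" using x i assignment_owner_unique[OF p, of x k i] by simp
        then show False using x k(3) by (simp add: mem_q')
      qed
      then show "x \<in> p i - q i - fst ` set c"
        using x \<sigma>(1) by (simp add: mem_q' permutes_not_in)
    qed
    let ?lost = "\<lambda>q. \<Union>i\<in>{1..n}. p i - q i"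
    \<comment> \<open>Any tail of the cycle is lost under \<open>q\<close> but not under
      \<open>q'\<close>, which makes the inclusion proper.\<close>
    obtain x where x: "x \<in> fst ` set c" using \<open>c \<noteq> []\<close> by (cases c) auto
    have "?lost q' \<subseteq> ?lost q - {x}"
    proof
      fix z assume "z \<in> ?lost q'"
      then obtain i where i: "i \<in> {1..n}" "z \<in> p i - q' i" by blast
      then have "z \<in> p i - q i - fst ` set c" using smaller by blast
      then show "z \<in> ?lost q - {x}" using i(1) x by blast
    qed
    moreover have "x \<in> ?lost q" using edge[OF x] by blast
    ultimately have "?lost q' \<subset> ?lost q" by blast
    then have "card (?lost q') < card (?lost q)"
      by (rule psubset_card_mono[OF lost_finite])
    moreover have "pareto_dominates n u q' p"
      using less.prems(2) same by (simp add: pareto_dominates_def)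
    ultimately show ?thesis using less.hyps[OF _ q'] by simp
  qed
qed

theorem theorem5:
  fixes n :: nat
    and Ob :: "'o set"
    and u :: "nat \<Rightarrow> 'o \<Rightarrow> real"
    and p :: "nat \<Rightarrow> 'o set"
  assumes "finite Ob"
    and "\<And>i x. i \<in> {1..n} \<Longrightarrow> x \<in> Ob \<Longrightarrow> u i x \<ge> 0"
    and "lexicographic n Ob u"
    and "assignment n Ob p"
  shows "\<not> pareto_optimal n Ob u p \<longleftrightarrow>
    (\<exists>c. pre_digraph.cycle (with_proj (exchange_graph n Ob u p)) c \<and>
         (\<exists>e\<in>set c. strict_edge n u p e))"
proof
  assume "\<not> pareto_optimal n Ob u p"
  then obtain q where "assignment n Ob q" "pareto_dominates n u q p"
    using assms(4) by (auto simp: pareto_optimal_def)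
  then show "\<exists>c. pre_digraph.cycle (with_proj (exchange_graph n Ob u p)) c \<and>
         (\<exists>e\<in>set c. strict_edge n u p e)"
    using dominated_imp_cycle[OF assms] by blast
next
  assume "\<exists>c. pre_digraph.cycle (with_proj (exchange_graph n Ob u p)) c \<and>
         (\<exists>e\<in>set c. strict_edge n u p e)"
  then show "\<not> pareto_optimal n Ob u p"
    using cycle_imp_dominated[OF assms(1,4)] by (auto simp: pareto_optimal_def)
qed

end
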